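(* Let $(\mathcal{A},C_S)$ be a symmetric complete composed $S$-metric space with non-constant control function $\alpha:[0,\infty)\to[0,\infty)$. Let $M_f\in\mathcal{M}_f$, with associated constant $r\in[0,1)$, and let $F:\mathcal{A}\to\mathcal{A}$ be a mapping such that for all $o,h\in\mathcal{A}$ $$C_S(Fo,Fo,Fh)\le M_f\big(C_S(o,o,h),\,C_S(Fo,Fo,o),\,C_S(Fo,Fo,h),\,C_S(Fh,Fh,o),\,C_S(Fh,Fh,h)\big).$$ Let $I_0\in\mathcal{A}$ and $I_n=F^nI_0$. Assume that: (i) $\alpha(ks+t)\le k\,\alpha(s)+\alpha(t)$ for all positive numbers $s,t,k$; (ii) $\alpha(0)=0$; (iii) $\alpha(C_S(I_n,I_n,I_{n+1}))\le C_S(I_n,I_n,I_{n+1})$ for all $n\in\mathbb{N}$; (iv) $$\lim_{\substack{n,m\to\infty\\ m>n}}\left[\sum_{k=n+3}^{m-2}2^{k-n-1}\alpha^{k-n+1}\big(r^kC_S(I_0,I_0,I_1)\big)+2^{m-n-3}\alpha^{m-n-1}\big(r^mC_S(I_0,I_0,I_1)\big)\right]=0.$$ Then $F$ has a unique fixed point.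
   Context: Composed $S$-metric space: let $\mathcal{A}$ be a nonempty set and $\alpha:[0,\infty)\to[0,\infty)$ a non-constant function (the control, or composed, function). A function $C_S:\mathcal{A}^3\to[0,\infty)$ is a composed $S$-metric if for all $q,h,w,u\in\mathcal{A}$: (1) $C_S(q,h,w)=0$ if and only if $q=h=w$; (2) $C_S(q,h,w)\le\alpha(C_S(q,q,u))+\alpha(C_S(h,h,u))+\alpha(C_S(w,w,u))$. The pair $(\mathcal{A},C_S)$ is then called a composed $S$-metric space. It is symmetric if $C_S(q,q,h)=C_S(h,h,q)$ for all $q,h\in\mathcal{A}$. A sequence $(q_n)$ in $\mathcal{A}$ converges to $q\in\mathcal{A}$ if $C_S(q_n,q_n,q)\to0$ as $n\to\infty$. It is Cauchy if $C_S(q_n,q_n,q_m)\to0$ as $n,m\to\infty$. The space is complete if every Cauchy sequence in it converges to a point of $\mathcal{A}$. The class $\mathcal{M}_f$: with $\mathbb{R}_+=[0,\infty)$, $\mathcal{M}_f$ is the set of all continuous functions $M_f:\mathbb{R}_+^5\to\mathbb{R}_+$ satisfying, for some $r\in[0,1)$ (the associated constant): ($M_1$) for all $o,h,w\in\mathbb{R}_+$, if $h\le M_f(o,o,0,w,h)$ and $w\le 2o+h$, then $h\le r\,o$; ($M_2$) for all $h\in\mathbb{R}_+$, if $h\le M_f(h,0,h,h,0)$, then $h=0$. $F^n$ denotes the $n$-fold composition of $F$, and $\alpha^j$ denotes the $j$-fold composition of $\alpha$ with itself ($\alpha^0$ is the identity). Empty sums are $0$. *)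

theory Defs
  imports "HOL-Analysis.Analysis"
begin

text \<open>
  Functions on \<open>[0,\<infinity>)\<close> and on the space \<open>\<A>\<close> are represented by total functions; every condition
  on them is restricted to nonnegative arguments, respectively to arguments in the carrier \<open>A\<close>.
\<close>

locale composed_S_metric_space =
  fixes A :: "'a set"
    and C :: "'a \<Rightarrow> 'a \<Rightarrow> 'a \<Rightarrow> real"
    and \<alpha> :: "real \<Rightarrow> real"
  assumes carrier_nonempty: "A \<noteq> {}"
    and control_nonneg: "\<And>t. 0 \<le> t \<Longrightarrow> 0 \<le> \<alpha> t"
    and control_nonconstant: "\<not> \<alpha> constant_on {0..}"
    and nonneg: "\<And>q h w. \<lbrakk>q \<in> A; h \<in> A; w \<in> A\<rbrakk> \<Longrightarrow> 0 \<le> C q h w"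
    and zero_iff: "\<And>q h w. \<lbrakk>q \<in> A; h \<in> A; w \<in> A\<rbrakk> \<Longrightarrow> C q h w = 0 \<longleftrightarrow> q = h \<and> h = w"
    and composed_triangle: "\<And>q h w u. \<lbrakk>q \<in> A; h \<in> A; w \<in> A; u \<in> A\<rbrakk> \<Longrightarrow>
          C q h w \<le> \<alpha> (C q q u) + \<alpha> (C h h u) + \<alpha> (C w w u)"

definition S_symmetric :: "'a set \<Rightarrow> ('a \<Rightarrow> 'a \<Rightarrow> 'a \<Rightarrow> real) \<Rightarrow> bool" where
  "S_symmetric A C \<longleftrightarrow> (\<forall>q\<in>A. \<forall>h\<in>A. C q q h = C h h q)"

definition S_converges :: "('a \<Rightarrow> 'a \<Rightarrow> 'a \<Rightarrow> real) \<Rightarrow> (nat \<Rightarrow> 'a) \<Rightarrow> 'a \<Rightarrow> bool" where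
  "S_converges C q l \<longleftrightarrow> (\<lambda>n. C (q n) (q n) l) \<longlonglongrightarrow> 0"

definition S_Cauchy :: "('a \<Rightarrow> 'a \<Rightarrow> 'a \<Rightarrow> real) \<Rightarrow> (nat \<Rightarrow> 'a) \<Rightarrow> bool" where
  "S_Cauchy C q \<longleftrightarrow>
     ((\<lambda>(n, m). C (q n) (q n) (q m)) \<longlongrightarrow> 0) (sequentially \<times>\<^sub>F sequentially)"

definition S_complete :: "'a set \<Rightarrow> ('a \<Rightarrow> 'a \<Rightarrow> 'a \<Rightarrow> real) \<Rightarrow> bool" where
  "S_complete A C \<longleftrightarrow>
     (\<forall>q. range q \<subseteq> A \<longrightarrow> S_Cauchy C q \<longrightarrow> (\<exists>l\<in>A. S_converges C q l))"

type_synonym real5 = "real \<times> real \<times> real \<times> real \<times> real"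

definition nonneg5 :: "real5 set" where
  "nonneg5 = {0..} \<times> {0..} \<times> {0..} \<times> {0..} \<times> {0..}"

definition Mf_constant :: "(real5 \<Rightarrow> real) \<Rightarrow> real \<Rightarrow> bool" where
  "Mf_constant M r \<longleftrightarrow> 0 \<le> r \<and> r < 1 \<and>
     (\<forall>p\<ge>0. \<forall>h\<ge>0. \<forall>w\<ge>0. h \<le> M (p, p, 0, w, h) \<longrightarrow> w \<le> 2 * p + h \<longrightarrow> h \<le> r * p)"

definition Mf_class :: "(real5 \<Rightarrow> real) set" where
  "Mf_class = {M. continuous_on nonneg5 M \<and> M ` nonneg5 \<subseteq> {0..} \<and>
     (\<exists>r. Mf_constant M r) \<and>
     (\<forall>h\<ge>0. h \<le> M (h, 0, h, h, 0) \<longrightarrow> h = 0)}"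

end

theory Submission
  imports Defs
begin

text \<open>
  Write \<open>d q h\<close> for \<open>C q q h\<close>. The triangle inequality through the middle point \<open>I (n + 1)\<close> and the
  bound \<open>\<alpha> (d (I n) (I (n + 1))) \<le> d (I n) (I (n + 1))\<close> put the consecutive distances of the orbit
  under the condition defining the constant \<open>r\<close>, so these distances decay like \<open>r ^ n\<close>. If one of them
  vanishes, the orbit has reached a fixed point.

  Otherwise they are arbitrarily small positive numbers \<open>s\<close> with \<open>\<alpha> s \<le> s\<close>. A given \<open>t > 0\<close> exceeds
  such an \<open>s\<close>, and \<open>\<alpha> (k * s + s) \<le> k * \<alpha> s + \<alpha> s\<close> with \<open>k * s + s = t\<close> gives \<open>\<alpha> t \<le> t\<close>
  (\<open>control_le_id\<close>). Thus \<open>\<alpha>\<close> lies below the identity on the whole half-line, and the composed triangle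
  inequality becomes that of an ordinary \<open>S\<close>-metric, \<open>d q w \<le> 2 * d q u + d u w\<close>, in which the second
  term carries no factor (\<open>triangle_below_id\<close>). Unfolding it along the orbit therefore costs only a
  geometric series (\<open>geometric_steps_imp_Cauchy\<close>), and it makes \<open>d\<close> continuous in its first point
  (\<open>S_converges_imp_tendsto\<close>). If \<open>l\<close> is the limit of the orbit, the contractive condition passes
  to the limit by continuity of \<open>M\<close>, giving \<open>h \<le> M (0, 0, 0, h, h)\<close> for \<open>h = d (F l) l\<close>; the
  constant \<open>r\<close> then forces \<open>h \<le> r * 0\<close>. Uniqueness is the second condition of the class of \<open>M\<close>.
\<close>

text \<open>Subadditivity along multiples of one point spreads the bound \<open>\<alpha> s \<le> s\<close> from \<open>s\<close> to all \<open>t > s\<close>;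
  small values of \<open>d n\<close> thereby reach every \<open>t\<close>.\<close>

lemma control_le_id:
  fixes \<alpha> :: "real \<Rightarrow> real" and d :: "nat \<Rightarrow> real"
  assumes sub: "\<And>s t k. \<lbrakk>s > 0; t > 0; k > 0\<rbrakk> \<Longrightarrow> \<alpha> (k * s + t) \<le> k * \<alpha> s + \<alpha> t"
    and zero: "\<alpha> 0 = 0"
    and pos: "\<And>n. d n > 0"
    and lim: "d \<longlonglongrightarrow> 0"
    and le: "\<And>n. \<alpha> (d n) \<le> d n"
    and t: "t \<ge> 0"
  shows "\<alpha> t \<le> t"
proof (cases "t = 0")
  case True
  then show ?thesis using zero by simp
next
  case False
  with t have "t > 0" by simp
  with lim have "\<forall>\<^sub>F n in sequentially. d n < t"
    by (rule order_tendstoD)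
  then obtain n where n: "d n < t"
    by (auto simp: eventually_sequentially)
  define k where "k = (t - d n) / d n"
  have k: "k > 0" and t_eq: "k * d n + d n = t"
    using pos[of n] n by (auto simp: k_def)
  have "\<alpha> t \<le> k * \<alpha> (d n) + \<alpha> (d n)"
    using sub[OF pos[of n] pos[of n] k] by (simp add: t_eq)
  also have "\<dots> \<le> k * d n + d n"
    using k le[of n] by (intro add_mono mult_left_mono) auto
  finally show ?thesis by (simp add: t_eq)
qed

context composed_S_metric_space
begin

lemma triangle_below_id:
  assumes sym: "S_symmetric A C"
    and le_id: "\<And>t. t \<ge> 0 \<Longrightarrow> \<alpha> t \<le> t"
    and A: "q \<in> A" "u \<in> A" "w \<in> A"
  shows "C q q w \<le> 2 * C q q u + C u u w"
proof -
  have "C q q w \<le> 2 * \<alpha> (C q q u) + \<alpha> (C w w u)"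
    using composed_triangle[of q q w u] A by simp
  also have "\<dots> \<le> 2 * C q q u + C w w u"
    using le_id[OF nonneg] A by (intro add_mono) auto
  also have "C w w u = C u u w"
    using sym A by (simp add: S_symmetric_def)
  finally show ?thesis .
qed

text \<open>The triangle inequality, used once in each direction, gives
  \<open>\<bar>C (x n) (x n) y - C l l y\<bar> \<le> 2 * C (x n) (x n) l\<close>: the factor falls on the vanishing term only.\<close>

lemma S_converges_imp_tendsto:
  assumes sym: "S_symmetric A C"
    and le_id: "\<And>t. t \<ge> 0 \<Longrightarrow> \<alpha> t \<le> t"
    and A: "\<And>n. x n \<in> A" "l \<in> A" "y \<in> A"
    and conv: "S_converges C x l"
  shows "(\<lambda>n. C (x n) (x n) y) \<longlonglongrightarrow> C l l y"
proof (rule LIM_zero_cancel, rule Lim_null_comparison)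
  show "(\<lambda>n. 2 * C (x n) (x n) l) \<longlonglongrightarrow> 0"
    using tendsto_mult_left[OF conv[unfolded S_converges_def], of 2] by simp
  show "\<forall>\<^sub>F n in sequentially. norm (C (x n) (x n) y - C l l y) \<le> 2 * C (x n) (x n) l"
  proof (rule always_eventually, rule allI)
    fix n
    have "C (x n) (x n) y \<le> 2 * C (x n) (x n) l + C l l y"
      using A by (intro triangle_below_id sym le_id)
    moreover have "C l l y \<le> 2 * C l l (x n) + C (x n) (x n) y"
      using A by (intro triangle_below_id sym le_id)
    moreover have "C l l (x n) = C (x n) (x n) l"
      using sym A by (simp add: S_symmetric_def)
    ultimately show "norm (C (x n) (x n) y - C l l y) \<le> 2 * C (x n) (x n) l"
      by (simp add: abs_le_iff)
  qed
qed

lemma geometric_steps_imp_Cauchy: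
  assumes sym: "S_symmetric A C"
    and le_id: "\<And>t. t \<ge> 0 \<Longrightarrow> \<alpha> t \<le> t"
    and A: "\<And>n. x n \<in> A"
    and r: "0 \<le> r" "r < 1"
    and step: "\<And>n. C (x n) (x n) (x (Suc n)) \<le> r ^ n * b"
  shows "S_Cauchy C x"
proof -
  define K where "K = 2 * b / (1 - r)"
  have K: "2 * b + r * K = K"
    using r by (simp add: K_def field_simps)
  have "0 \<le> b"
    using nonneg[OF A A A, of 0 0 1] step[of 0] by simp
  with r have K0: "0 \<le> K" by (simp add: K_def)
  have forward: "C (x n) (x n) (x (n + j)) \<le> K * r ^ n" for n j
  proof (induction j arbitrary: n)
    case 0
    then show ?case using zero_iff[OF A A A, of n n n] r K0 by simp
  next
    \<comment> \<open>Peeling off the first step keeps the factor \<open>2\<close> away from the remaining distance.\<close>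
    case (Suc j)
    have "C (x n) (x n) (x (n + Suc j))
        \<le> 2 * C (x n) (x n) (x (Suc n)) + C (x (Suc n)) (x (Suc n)) (x (Suc n + j))"
      using triangle_below_id[OF sym le_id A A A] by simp
    also have "\<dots> \<le> 2 * (r ^ n * b) + K * r ^ Suc n"
      using step[of n] Suc.IH[of "Suc n"] by simp
    also have "\<dots> = (2 * b + r * K) * r ^ n"
      by (simp add: algebra_simps)
    finally show ?case by (simp only: K)
  qed
  have bound: "C (x n) (x n) (x m) \<le> K * r ^ n + K * r ^ m" for n m
  proof (cases "n \<le> m")
    case True
    then have "C (x n) (x n) (x m) \<le> K * r ^ n"
      using forward[of n "m - n"] by simp
    then show ?thesis using K0 r by (simp add: add_increasing2)
  next
    case False
    then have "C (x m) (x m) (x n) \<le> K * r ^ m"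
      using forward[of m "n - m"] by simp
    moreover have "C (x n) (x n) (x m) = C (x m) (x m) (x n)"
      using sym A by (simp add: S_symmetric_def)
    ultimately show ?thesis using K0 r by (simp add: add_increasing)
  qed
  have geo: "(\<lambda>n. K * r ^ n) \<longlonglongrightarrow> 0"
    using tendsto_mult_left[OF LIMSEQ_realpow_zero[OF r], of K] by simp
  have lim: "((\<lambda>p. K * r ^ fst p + K * r ^ snd p) \<longlongrightarrow> 0)
      (sequentially \<times>\<^sub>F sequentially)"
    using tendsto_add[OF filterlim_compose[OF geo filterlim_fst]
        filterlim_compose[OF geo filterlim_snd]] by simp
  show ?thesis
    unfolding S_Cauchy_def
    by (rule Lim_null_comparison[OF _ lim])
      (auto intro!: always_eventually simp: bound nonneg A)
qed

end

theorem theorem3p2: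
  fixes A :: "'a set"
    and C :: "'a \<Rightarrow> 'a \<Rightarrow> 'a \<Rightarrow> real"
    and \<alpha> :: "real \<Rightarrow> real"
    and M :: "real \<times> real \<times> real \<times> real \<times> real \<Rightarrow> real"
    and r :: real
    and F :: "'a \<Rightarrow> 'a"
    and I :: "nat \<Rightarrow> 'a"
  assumes space: "composed_S_metric_space A C \<alpha>"
    and symmetric: "S_symmetric A C"
    and complete: "S_complete A C"
    and M_class: "M \<in> Mf_class"
    and M_const: "Mf_constant M r"
    and F_maps: "F \<in> A \<rightarrow> A"
    and F_contr: "\<And>p h. \<lbrakk>p \<in> A; h \<in> A\<rbrakk> \<Longrightarrow>
          C (F p) (F p) (F h) \<le>
            M (C p p h, C (F p) (F p) p, C (F p) (F p) h, C (F h) (F h) p, C (F h) (F h) h)"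
    and I_start: "I 0 \<in> A"
    and I_iter: "\<And>n. I n = (F ^^ n) (I 0)"
    and i: "\<And>s t k. \<lbrakk>s > 0; t > 0; k > 0\<rbrakk> \<Longrightarrow> \<alpha> (k * s + t) \<le> k * \<alpha> s + \<alpha> t"
    and ii: "\<alpha> 0 = 0"
    and iii: "\<And>n. \<alpha> (C (I n) (I n) (I (Suc n))) \<le> C (I n) (I n) (I (Suc n))"
    and iv: "((\<lambda>(n, m).
            (\<Sum>k = n + 3..m - 2.
               2 ^ (k - n - 1) * (\<alpha> ^^ (k - n + 1)) (r ^ k * C (I 0) (I 0) (I 1)))
            + 2 powi (int m - int n - 3) *
               (\<alpha> ^^ (m - n - 1)) (r ^ m * C (I 0) (I 0) (I 1)))
          \<longlongrightarrow> 0) (inf (sequentially \<times>\<^sub>F sequentially) (principal {(n, m). n < m}))"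
  shows "\<exists>!p. p \<in> A \<and> F p = p"
proof -
  interpret composed_S_metric_space A C \<alpha> by (rule space)
  have sym: "C h h q = C q q h" if "q \<in> A" "h \<in> A" for q h
    using symmetric that by (simp add: S_symmetric_def)
  have r: "0 \<le> r" "r < 1"
    and M1: "\<And>p h w. \<lbrakk>p \<ge> 0; h \<ge> 0; w \<ge> 0; h \<le> M (p, p, 0, w, h); w \<le> 2 * p + h\<rbrakk> \<Longrightarrow> h \<le> r * p"
    using M_const by (auto simp: Mf_constant_def)
  have M_cont: "continuous_on nonneg5 M"
    and M2: "\<And>h. \<lbrakk>h \<ge> 0; h \<le> M (h, 0, h, h, 0)\<rbrakk> \<Longrightarrow> h = 0"
    using M_class by (auto simp: Mf_class_def)
  have diag: "C q q q = 0" if "q \<in> A" for q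
    using zero_iff that by simp
  have F_A: "F q \<in> A" if "q \<in> A" for q
    using F_maps that by auto
  have I_Suc: "I (Suc n) = F (I n)" for n
    using I_iter[of "Suc n"] I_iter[of n] by simp
  have I_A: "I n \<in> A" for n
    by (induction n) (auto simp: I_start I_Suc F_A)

  define d where "d n = C (I n) (I n) (I (Suc n))" for n
  have d_nonneg: "d n \<ge> 0" for n
    by (simp add: d_def nonneg I_A)
  have d_le: "\<alpha> (d n) \<le> d n" for n
    using iii[of n] by (simp add: d_def)
  have d_step: "d (Suc n) \<le> r * d n" for n
  proof (rule M1[OF d_nonneg d_nonneg])
    let ?w = "C (I (Suc (Suc n))) (I (Suc (Suc n))) (I n)"
    show "?w \<ge> 0" by (simp add: nonneg I_A)
    show "d (Suc n) \<le> M (d n, d n, 0, ?w, d (Suc n))"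
      using F_contr[OF I_A[of n] I_A[of "Suc n"]]
      by (simp add: d_def diag I_A sym[of "I n" "I (Suc n)"]
          sym[of "I (Suc n)" "I (Suc (Suc n))"] flip: I_Suc)
    have "?w = C (I n) (I n) (I (Suc (Suc n)))"
      by (rule sym[OF I_A I_A])
    also have "\<dots> \<le> 2 * \<alpha> (d n) + \<alpha> (C (I (Suc (Suc n))) (I (Suc (Suc n))) (I (Suc n)))"
      using composed_triangle[OF I_A I_A I_A I_A, of n n "Suc (Suc n)" "Suc n"]
      by (simp add: d_def)
    also have "C (I (Suc (Suc n))) (I (Suc (Suc n))) (I (Suc n)) = d (Suc n)"
      unfolding d_def by (rule sym[OF I_A I_A])
    also have "2 * \<alpha> (d n) + \<alpha> (d (Suc n)) \<le> 2 * d n + d (Suc n)"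
      using d_le[of n] d_le[of "Suc n"] by simp
    finally show "?w \<le> 2 * d n + d (Suc n)" .
  qed
  have d_geometric: "d n \<le> r ^ n * d 0" for n
  proof (induction n)
    case (Suc n)
    then have "r * d n \<le> r * (r ^ n * d 0)"
      using r by (intro mult_left_mono) auto
    then show ?case using d_step[of n] by (simp add: mult.assoc)
  qed simp

  have "\<exists>p\<in>A. F p = p"
  proof (cases "\<exists>n. d n = 0")
    case True
    then obtain n where "C (I n) (I n) (F (I n)) = 0"
      by (auto simp: d_def I_Suc)
    then have "F (I n) = I n"
      using zero_iff[OF I_A I_A F_A[OF I_A], of n n n] by simp
    then show ?thesis using I_A by blast
  next
    case False
    then have d_pos: "d n > 0" for n
      using d_nonneg[of n] by (simp add: order_less_le)
    have d_lim: "d \<longlonglongrightarrow> 0"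
    proof (rule Lim_null_comparison)
      show "\<forall>\<^sub>F n in sequentially. norm (d n) \<le> r ^ n * d 0"
        using d_nonneg d_geometric by simp
      show "(\<lambda>n. r ^ n * d 0) \<longlonglongrightarrow> 0"
        using tendsto_mult_right[OF LIMSEQ_realpow_zero[OF r], of "d 0"] by simp
    qed
    have le_id: "\<alpha> t \<le> t" if "t \<ge> 0" for t
      using i ii d_pos d_lim d_le that by (rule control_le_id)
    have "S_Cauchy C I"
      using symmetric le_id I_A r d_geometric[unfolded d_def[of n for n]]
      by (rule geometric_steps_imp_Cauchy)
    then obtain l where l: "l \<in> A" and conv: "S_converges C I l"
      using complete I_A unfolding S_complete_def by blast
    have lim: "(\<lambda>n. C (I n) (I n) y) \<longlonglongrightarrow> C l l y" if "y \<in> A" for y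
      by (rule S_converges_imp_tendsto[OF symmetric le_id I_A l that conv])
    define h where "h = C (F l) (F l) l"
    have h_nonneg: "h \<ge> 0" by (simp add: h_def nonneg l F_A)
    have lim_l: "(\<lambda>n. C (I n) (I n) l) \<longlonglongrightarrow> 0"
      using lim[OF l] by (simp add: diag l)
    have lim_Fl: "(\<lambda>n. C (I n) (I n) (F l)) \<longlonglongrightarrow> h"
      using lim[OF F_A[OF l]] by (simp add: h_def sym[of l "F l"] l F_A)
    let ?v = "\<lambda>n. (C (I n) (I n) l, d n, C (I (Suc n)) (I (Suc n)) l, C (I n) (I n) (F l), h)"
    have "?v \<longlonglongrightarrow> (0, 0, 0, h, h)"
      by (intro tendsto_Pair lim_l d_lim lim_Fl tendsto_const LIMSEQ_Suc)
    moreover have "(0, 0, 0, h, h) \<in> nonneg5" "?v n \<in> nonneg5" for n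
      by (auto simp: nonneg5_def h_nonneg d_nonneg nonneg I_A l F_A)
    ultimately have "(\<lambda>n. M (?v n)) \<longlonglongrightarrow> M (0, 0, 0, h, h)"
      by (intro continuous_on_tendsto_compose[OF M_cont]) auto
    moreover have "(\<lambda>n. C (I (Suc n)) (I (Suc n)) (F l)) \<longlonglongrightarrow> h"
      by (rule LIMSEQ_Suc[OF lim_Fl])
    moreover have "C (I (Suc n)) (I (Suc n)) (F l) \<le> M (?v n)" for n
      using F_contr[OF I_A[of n] l]
      by (simp add: d_def h_def sym[of "I n" "I (Suc n)"] sym[of "I n" "F l"]
          I_A l F_A flip: I_Suc)
    ultimately have "h \<le> M (0, 0, 0, h, h)"
      by (intro LIMSEQ_le) auto
    then have "h \<le> r * 0"
      using h_nonneg by (intro M1[where w = h]) auto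
    with h_nonneg have "h = 0" by simp
    then have "F l = l"
      using zero_iff[OF F_A[OF l] F_A[OF l] l] by (simp add: h_def)
    with l show ?thesis by blast
  qed
  moreover have "p = q" if "p \<in> A" "F p = p" "q \<in> A" "F q = q" for p q
  proof -
    have "C p p q \<le> M (C p p q, 0, C p p q, C p p q, 0)"
      using F_contr[of p q] that by (simp add: diag sym[of p q])
    then have "C p p q = 0"
      using M2 nonneg that by blast
    then show "p = q" using zero_iff that by simp
  qed
  ultimately show ?thesis by blast
qed

end
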